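(* Let $n\ge2$ and let $\mathcal{A}^B_n$ be the set of $B$-arc permutations in $B_n$. Then $$\sum_{\pi\in\mathcal{A}^B_n} \mathbf{x}^{\mathrm{Des}(\pi)}= \prod_{i=1}^{n-1}(1+x_i)\left(2+n+2\sum_{i=1}^{n-2}\frac{x_i+x_{i+1}}{(1+x_i)(1+x_{i+1})}\right).$$
   Context: $B_n$ is the group of bijections $\pi$ of $\{\pm1,\dots,\pm n\}$ with $\pi(-a)=-\pi(a)$, written $\pi=[\pi(1),\dots,\pi(n)]$. Let $\mathcal{O}_n$ be a circle with $2n$ points labeled $-1,\dots,-n,1,\dots,n$ in clockwise order; an interval in $\mathcal{O}_n$ is a set of cyclically consecutive points. $\pi\in B_n$ is a $B$-arc permutation if for every $1\le j\le n$ the set $\{\pi(j),\dots,\pi(n)\}$ is an interval in $\mathcal{O}_n$. Descents are with respect to the order $-1<-2<\cdots<-n<1<\cdots<n$: $\mathrm{Des}(\pi)=\{1\le i\le n-1:\pi(i)>\pi(i+1)\}$. For $D=\{i_1,\dots,i_k\}$, $\mathbf{x}^D=x_{i_1}\cdots x_{i_k}$. *)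

theory Defs
  imports
    "HOL-Combinatorics.Permutations"
    "HOL-Computational_Algebra.Fraction_Field"
    "HOL-Library.Poly_Mapping"
begin

text \<open>A signed permutation is extended by the identity outside \<open>{\<plusminus>1, \<dots>, \<plusminus>n}\<close> (this is
  part of \<^const>\<open>permutes\<close>), so that distinct elements of the set below are distinct elements
  of the hyperoctahedral group.\<close>

definition signed_points :: "nat \<Rightarrow> int set" where
  "signed_points n = {- int n..int n} - {0}"

definition signed_perms :: "nat \<Rightarrow> (int \<Rightarrow> int) set" where
  "signed_perms n =
     {\<pi>. \<pi> permutes signed_points n \<and> (\<forall>a\<in>signed_points n. \<pi> (- a) = - \<pi> a)}"

text \<open>The label of the \<open>k\<close>-th point of the circle in clockwise order, for \<open>k < 2 * n\<close>:
  \<open>-1, -2, \<dots>, -n, 1, 2, \<dots>, n\<close>.\<close>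

definition circle_point :: "nat \<Rightarrow> nat \<Rightarrow> int" where
  "circle_point n k = (if k < n then - (int k + 1) else int k - int n + 1)"

definition circle_interval :: "nat \<Rightarrow> int set \<Rightarrow> bool" where
  "circle_interval n S \<longleftrightarrow>
     (\<exists>s m. m \<le> 2 * n \<and> S = (\<lambda>k. circle_point n ((s + k) mod (2 * n))) ` {..<m})"

definition B_arc_perms :: "nat \<Rightarrow> (int \<Rightarrow> int) set" where
  "B_arc_perms n =
     {\<pi>\<in>signed_perms n. \<forall>j\<in>{1..n}. circle_interval n (\<pi> ` {int j..int n})}"

text \<open>The order \<open>-1 < -2 < \<dots> < -n < 1 < 2 < \<dots> < n\<close>; it is only meant for nonzero arguments.\<close>

definition B_less :: "int \<Rightarrow> int \<Rightarrow> bool" where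
  "B_less a b \<longleftrightarrow> (a < 0 \<and> 0 < b) \<or> (a < 0 \<and> b < 0 \<and> b < a) \<or> (0 < a \<and> 0 < b \<and> a < b)"

definition Des :: "nat \<Rightarrow> (int \<Rightarrow> int) \<Rightarrow> nat set" where
  "Des n \<pi> = {i\<in>{1..n - 1}. B_less (\<pi> (int i + 1)) (\<pi> (int i))}"

text \<open>The identity is stated in the field of fractions of the polynomial ring
  \<open>\<int>[x\<^sub>0, x\<^sub>1, x\<^sub>2, \<dots>]\<close>. A polynomial is a finitely supported map from monomials to
  coefficients, and a monomial is a finitely supported map from variable indices to exponents.\<close>

type_synonym int_mpoly = "(nat \<Rightarrow>\<^sub>0 nat) \<Rightarrow>\<^sub>0 int"

definition X :: "nat \<Rightarrow> int_mpoly fract" where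
  "X i = Fract (Poly_Mapping.single (Poly_Mapping.single i 1) 1) 1"

definition X_pow_set :: "nat set \<Rightarrow> int_mpoly fract" where
  "X_pow_set D = (\<Prod>i\<in>D. X i)"

end

theory Submission
  imports Defs
begin

text \<open>Read from left to right, a \<open>B\<close>-arc permutation peels an arc of length \<open>n\<close> from its two ends,
  so it is encoded by the starting position \<open>s < 2 * n\<close> of that arc and the set \<open>D\<close> of the steps
  \<open>i < n\<close> at which the right end is removed. If the arc does not wrap around (\<open>s \<le> n\<close>), the descent
  set is \<open>D\<close>, which gives \<open>n + 1\<close> times the full product. If it wraps around, let \<open>k\<close> be the first
  step at which the points on one side of the gap are exhausted. For fixed \<open>D\<close>, this \<open>k\<close>
  determines \<open>s\<close> and ranges over \<open>1, \<dots>, n - 1\<close>; and \<open>i\<close> is a descent iff \<open>i + 1 \<in> D\<close> for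
  \<open>i < k\<close>, iff \<open>k \<notin> D\<close> for \<open>i = k\<close>, and iff \<open>i \<in> D\<close> for \<open>i > k\<close>. For fixed \<open>k\<close> the sum over \<open>D\<close>
  factorises: \<open>k = 1\<close> gives the full product once more, and \<open>k > 1\<close> gives the summand with
  \<open>i = k - 1\<close>.\<close>

subsection \<open>Arcs of the circle\<close>

text \<open>Extends the labelling periodically to all naturals, so that arcs become images of
  ordinary segments and only the reduction modulo \<open>2 * n\<close> sees wrap-around.\<close>

definition cyc_point :: "nat \<Rightarrow> nat \<Rightarrow> int" where
  "cyc_point n k = circle_point n (k mod (2 * n))"

definition arc :: "nat \<Rightarrow> nat \<Rightarrow> nat \<Rightarrow> int set" where
  "arc n s m = cyc_point n ` {s..<s + m}"

lemma cyc_point_eq_iff: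
  assumes "n > 0"
  shows "cyc_point n k = cyc_point n l \<longleftrightarrow> k mod (2 * n) = l mod (2 * n)"
  unfolding cyc_point_def circle_point_def by (auto split: if_splits)

lemma cyc_point_in_signed_points:
  assumes "n > 0"
  shows "cyc_point n k \<in> signed_points n"
proof -
  have "k mod (2 * n) < 2 * n" using assms by simp
  then show ?thesis
    unfolding cyc_point_def circle_point_def signed_points_def by auto
qed

lemma cyc_point_add:
  assumes "n > 0"
  shows "cyc_point n (k + n) = - cyc_point n k"
proof -
  define r where "r = k mod (2 * n)"
  have r: "r < 2 * n" using assms by (simp add: r_def)
  have "(k + n) mod (2 * n) = (r + n) mod (2 * n)"
    unfolding r_def by (rule mod_add_left_eq[symmetric])
  also have "\<dots> = (if r < n then r + n else r - n)"
    using r by (simp add: le_mod_geq)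
  finally have "(k + n) mod (2 * n) = (if r < n then r + n else r - n)" .
  then show ?thesis
    using r by (auto simp: cyc_point_def circle_point_def simp flip: r_def)
qed

text \<open>The order is the clockwise order of the circle cut open before \<open>-1\<close>, so
  descents can be read off from reduced positions.\<close>

lemma B_less_cyc_point_iff:
  assumes "n > 0"
  shows "B_less (cyc_point n k) (cyc_point n l) \<longleftrightarrow> k mod (2 * n) < l mod (2 * n)"
  unfolding cyc_point_def circle_point_def B_less_def by auto

section \<open>Sizes of arcs and their sub-arcs\<close>

lemma cyc_point_add_neq:
  assumes "0 < d" "d < 2 * n"
  shows "cyc_point n (k + d) \<noteq> cyc_point n k"
proof
  assume "cyc_point n (k + d) = cyc_point n k"
  then have "(k + d) mod (2 * n) = k mod (2 * n)"
    using assms by (subst (asm) cyc_point_eq_iff) auto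
  then have "2 * n dvd k + d - k" by (subst (asm) mod_eq_dvd_iff_nat) auto
  then show False using assms by (auto dest: dvd_imp_le)
qed

lemma inj_on_cyc_point:
  assumes "m \<le> 2 * n"
  shows "inj_on (cyc_point n) {s..<s + m}"
proof (rule linorder_inj_onI)
  fix x y assume "x < y" "x \<in> {s..<s + m}" "y \<in> {s..<s + m}"
  then obtain d where "y = x + d" "0 < d" "d < m"
    using less_imp_add_positive[of x y] by auto
  then show "cyc_point n x \<noteq> cyc_point n y"
    using cyc_point_add_neq[of d n x] assms by auto
qed auto

lemma card_arc: "m \<le> 2 * n \<Longrightarrow> card (arc n s m) = m"
  unfolding arc_def by (simp add: card_image inj_on_cyc_point)

lemma cyc_point_notin_arc:
  assumes "m < 2 * n"
  shows "cyc_point n (s + m) \<notin> arc n s m"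
proof
  assume "cyc_point n (s + m) \<in> arc n s m"
  then obtain k where "s \<le> k" "k < s + m" "cyc_point n (s + m) = cyc_point n k"
    by (auto simp: arc_def)
  then show False
    using inj_on_cyc_point[of "Suc m" n s] assms inj_onD[of "cyc_point n" "{s..<s + Suc m}" "s + m" k]
    by simp
qed

lemma circle_interval_iff: "circle_interval n S \<longleftrightarrow> (\<exists>s m. m \<le> 2 * n \<and> S = arc n s m)"
proof -
  have "arc n s m = (\<lambda>k. circle_point n ((s + k) mod (2 * n))) ` {..<m}" for s m
  proof -
    have "{s..<s + m} = (+) s ` {..<m}" by (simp add: lessThan_atLeast0 add.commute)
    then show ?thesis by (simp only: arc_def cyc_point_def image_image)
  qed
  then show ?thesis by (simp add: circle_interval_def)
qed

lemma arc_cong: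
  assumes "s mod (2 * n) = t mod (2 * n)"
  shows "arc n s m = arc n t m"
proof -
  have "arc n s m = (\<lambda>k. cyc_point n (s + k)) ` {..<m}" for s
  proof -
    have "{s..<s + m} = (+) s ` {..<m}" by (simp add: lessThan_atLeast0 add.commute)
    then show ?thesis by (simp only: arc_def image_image)
  qed
  moreover have "cyc_point n (s + k) = cyc_point n (t + k)" for k
    using mod_add_cong[OF assms refl, of k] by (simp only: cyc_point_def)
  ultimately show ?thesis by simp
qed

lemma arc_mod: "arc n (s mod (2 * n)) m = arc n s m"
  by (rule arc_cong) simp

lemma arc_Suc: "arc n s (Suc m) = insert (cyc_point n (s + m)) (arc n s m)"
  unfolding arc_def by (simp add: atLeastLessThanSuc)

lemma arc_Suc': "arc n s (Suc m) = insert (cyc_point n s) (arc n (Suc s) m)"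
proof -
  have "{s..<s + Suc m} = insert s {Suc s..<Suc s + m}" by auto
  then show ?thesis by (simp only: arc_def image_insert)
qed

text \<open>The start of the smaller arc lies in the larger one at some offset \<open>d\<close>.
  Running past the end would include the point following the larger arc, which lies outside because
  that arc is not the full circle.\<close>

lemma arc_subset_arcE:
  assumes "arc n t m \<subseteq> arc n s m'" "0 < m" "m' < 2 * n"
  obtains d where "d + m \<le> m'" "arc n t m = arc n (s + d) m" "t mod (2 * n) = (s + d) mod (2 * n)"
proof -
  have "cyc_point n t \<in> arc n t m" using assms(2) by (auto simp: arc_def)
  then have "cyc_point n t \<in> arc n s m'" using assms(1) by blast
  then obtain u where u: "s \<le> u" "u < s + m'" "cyc_point n t = cyc_point n u"
    unfolding arc_def by auto
  define d where "d = u - s"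
  have eq: "t mod (2 * n) = (s + d) mod (2 * n)"
    using u(1,3) assms(3) by (simp add: cyc_point_eq_iff d_def)
  then have arc_eq: "arc n t m = arc n (s + d) m" by (rule arc_cong)
  have "d + m \<le> m'"
  proof (rule ccontr)
    assume "\<not> d + m \<le> m'"
    then have "cyc_point n (s + m') \<in> arc n (s + d) m"
      using u unfolding arc_def d_def by (intro imageI) auto
    then show False using cyc_point_notin_arc[OF assms(3), of s] assms(1) arc_eq by auto
  qed
  then show ?thesis using that[of d] eq arc_eq by simp
qed

lemma arc_inject:
  assumes "arc n s m = arc n t m" "0 < m" "m < 2 * n" "s < 2 * n" "t < 2 * n"
  shows "s = t"
proof -
  obtain d where "d + m \<le> m" "s mod (2 * n) = (t + d) mod (2 * n)"
    using arc_subset_arcE[of n s m t m] assms(1-3) by blast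
  then show ?thesis using assms(4,5) by simp
qed

text \<open>A sub-arc with one point fewer has offset 0 or 1, so the missing point is an end. This
  turns the arc condition into a left-or-right choice.\<close>

lemma arc_remove:
  assumes "arc n s (Suc m) - {x} = arc n t m" "x \<in> arc n s (Suc m)" "0 < m" "Suc m < 2 * n"
  shows "x = cyc_point n s \<and> arc n t m = arc n (Suc s) m \<or>
         x = cyc_point n (s + m) \<and> arc n t m = arc n s m"
proof -
  have sub: "arc n t m \<subseteq> arc n s (Suc m)" unfolding assms(1)[symmetric] by (rule Diff_subset)
  obtain d where d: "d + m \<le> Suc m" "arc n t m = arc n (s + d) m"
    by (rule arc_subset_arcE[OF sub assms(3,4)])
  have x: "x \<notin> arc n t m" unfolding assms(1)[symmetric] by simp
  consider "d = 0" | "d = 1" using d(1) by linarith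
  then show ?thesis
  proof cases
    case 1
    then have "arc n t m = arc n s m" using d(2) by simp
    then show ?thesis using x assms(2) unfolding arc_Suc by blast
  next
    case 2
    then have "arc n t m = arc n (Suc s) m" using d(2) by simp
    then show ?thesis using x assms(2) unfolding arc_Suc' by blast
  qed
qed

subsection \<open>Peeling an arc from its two ends\<close>

definition lefts :: "nat set \<Rightarrow> nat \<Rightarrow> nat" where
  "lefts D i = card ({1..<i} - D)"

definition rights :: "nat set \<Rightarrow> nat \<Rightarrow> nat" where
  "rights D i = card ({1..<i} \<inter> D)"

lemma lefts_Suc: "1 \<le> i \<Longrightarrow> lefts D (Suc i) = (if i \<in> D then lefts D i else Suc (lefts D i))"
  unfolding lefts_def by (simp add: atLeastLessThanSuc insert_Diff_if)

lemma rights_Suc: "1 \<le> i \<Longrightarrow> rights D (Suc i) = (if i \<in> D then Suc (rights D i) else rights D i)"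
  unfolding rights_def by (simp add: atLeastLessThanSuc)

lemma lefts_rights: "lefts D i + rights D i = i - 1"
  unfolding lefts_def rights_def
  using card_Diff_subset_Int[of "{1..<i}" D] card_mono[of "{1..<i}" "{1..<i} \<inter> D"] by simp

lemma lefts_1 [simp]: "lefts D (Suc 0) = 0" and rights_1 [simp]: "rights D (Suc 0) = 0"
  by (simp_all add: lefts_def rights_def)

lemma lefts_cong: "D \<inter> {1..<i} = E \<inter> {1..<i} \<Longrightarrow> lefts D i = lefts E i"
  unfolding lefts_def by (rule arg_cong[where f = card]) blast

lemma rights_cong: "D \<inter> {1..<i} = E \<inter> {1..<i} \<Longrightarrow> rights D i = rights E i"
  unfolding rights_def by (rule arg_cong[where f = card]) blast

text \<open>The points \<open>\<pi>(1), \<pi>(2), \<dots>\<close> are removed one by one from the arc of length \<open>n\<close>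
  starting at \<open>s\<close>: the right end is removed at step \<open>i\<close> if \<open>i \<in> D\<close>, the left end otherwise.
  Positions are not reduced modulo \<open>2 * n\<close>.\<close>

definition peel_pos :: "nat \<Rightarrow> nat \<Rightarrow> nat set \<Rightarrow> nat \<Rightarrow> nat" where
  "peel_pos n s D i = (if i \<in> D then s + (n - 1 - rights D i) else s + lefts D i)"

text \<open>Downward induction from \<open>j = n\<close>: step \<open>j\<close> restores one end of
  the segment of later positions. The last point is both ends at once and counts as a left end,
  since \<open>n\<close> is not in \<open>D\<close>.\<close>

lemma peel_pos_image:
  assumes "D \<subseteq> {1..<n}" "1 \<le> j" "j \<le> n"
  shows "peel_pos n s D ` {j..n} = {s + lefts D j..<s + lefts D j + (n + 1 - j)}"
  using assms(3,2)
proof (induction j rule: inc_induct)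
  case base
  have "n \<notin> D" using assms(1) by auto
  then show ?case by (auto simp: peel_pos_def)
next
  case (step j)
  have j: "1 \<le> j" "j < n" using step.hyps step.prems by auto
  have IH: "peel_pos n s D ` {Suc j..n} = {s + lefts D (Suc j)..<s + lefts D (Suc j) + (n - j)}"
    using step.IH by simp
  have "{j..n} = insert j {Suc j..n}" using j by auto
  then have img: "peel_pos n s D ` {j..n} = insert (peel_pos n s D j) (peel_pos n s D ` {Suc j..n})"
    by simp
  show ?case
  proof (cases "j \<in> D")
    case True
    then have "peel_pos n s D j = s + lefts D j + (n - j)"
      using lefts_rights[of D j] j by (simp add: peel_pos_def)
    then show ?thesis unfolding img IH using True j by (auto simp: lefts_Suc)
  next
    case False
    then show ?thesis unfolding img IH using j by (auto simp: lefts_Suc peel_pos_def)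
  qed
qed

lemma peel_pos_image_1:
  assumes "D \<subseteq> {1..<n}" "1 \<le> n"
  shows "peel_pos n s D ` {1..n} = {s..<s + n}"
  using peel_pos_image[of D n 1] assms by simp

lemma peel_pos_bounds:
  assumes "D \<subseteq> {1..<n}" "1 \<le> i" "i \<le> n"
  shows "s \<le> peel_pos n s D i" "peel_pos n s D i < s + n"
  using peel_pos_image_1[of D n s] assms by force+

lemma peel_pos_less:
  assumes "D \<subseteq> {1..<n}" "1 \<le> i" "i < j" "j \<le> n"
  shows "if i \<in> D then peel_pos n s D j < peel_pos n s D i else peel_pos n s D i < peel_pos n s D j"
proof -
  have "peel_pos n s D j \<in> peel_pos n s D ` {Suc i..n}" using assms by auto
  then have "peel_pos n s D j \<in> {s + lefts D (Suc i)..<s + lefts D (Suc i) + (n - i)}"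
    using assms by (subst (asm) peel_pos_image) auto
  moreover have "lefts D i + rights D i = i - 1" by (rule lefts_rights)
  ultimately show ?thesis using assms by (auto simp: peel_pos_def lefts_Suc)
qed

section \<open>Peelings as signed permutations\<close>

definition peel_perm :: "nat \<Rightarrow> nat \<Rightarrow> nat set \<Rightarrow> int \<Rightarrow> int" where
  "peel_perm n s D a =
     (if 1 \<le> a \<and> a \<le> int n then cyc_point n (peel_pos n s D (nat a))
      else if 1 \<le> - a \<and> - a \<le> int n then - cyc_point n (peel_pos n s D (nat (- a)))
      else a)"

lemma peel_perm_of_nat:
  "1 \<le> i \<Longrightarrow> i \<le> n \<Longrightarrow> peel_perm n s D (int i) = cyc_point n (peel_pos n s D i)"
  by (simp add: peel_perm_def)

lemma peel_perm_image:
  assumes "D \<subseteq> {1..<n}" "1 \<le> j" "j \<le> n"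
  shows "peel_perm n s D ` {int j..int n} = arc n (s + lefts D j) (n + 1 - j)"
proof -
  have "peel_perm n s D ` {int j..int n} = (\<lambda>i. peel_perm n s D (int i)) ` {j..n}"
    by (simp add: image_image flip: image_int_atLeastAtMost)
  also have "\<dots> = (\<lambda>i. cyc_point n (peel_pos n s D i)) ` {j..n}"
    using assms by (intro image_cong) (auto simp: peel_perm_of_nat)
  also have "\<dots> = cyc_point n ` peel_pos n s D ` {j..n}" by (simp add: image_image)
  also have "\<dots> = arc n (s + lefts D j) (n + 1 - j)"
    unfolding peel_pos_image[OF assms] arc_def ..
  finally show ?thesis .
qed

lemma peel_perm_minus: "a \<noteq> 0 \<Longrightarrow> peel_perm n s D (- a) = - peel_perm n s D a"
  by (auto simp: peel_perm_def)

lemma signed_points_eq_arc: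
  assumes "n > 0"
  shows "signed_points n = arc n s (2 * n)"
proof (rule card_seteq[symmetric])
  show "finite (signed_points n)" by (simp add: signed_points_def)
  show "arc n s (2 * n) \<subseteq> signed_points n"
    using cyc_point_in_signed_points[OF assms] by (auto simp: arc_def)
  show "card (signed_points n) \<le> card (arc n s (2 * n))"
    by (simp add: card_arc) (simp add: signed_points_def card_Diff_singleton)
qed

lemma uminus_arc:
  assumes "n > 0"
  shows "uminus ` arc n s m = arc n (s + n) m"
proof -
  have "{s + n..<s + n + m} = (\<lambda>k. k + n) ` {s..<s + m}" by (simp add: ac_simps)
  then show ?thesis by (simp only: arc_def image_image cyc_point_add[OF assms])
qed

text \<open>The values at \<open>1, ..., n\<close> fill an arc of length \<open>n\<close>, those at
  \<open>-1, ..., -n\<close> the antipodal arc. Together they cover the circle, and a surjection of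
  a finite set onto itself is bijective.\<close>

lemma peel_perm_in_signed_perms:
  assumes "D \<subseteq> {1..<n}" "1 \<le> n"
  shows "peel_perm n s D \<in> signed_perms n"
proof -
  have pts: "signed_points n = {1..int n} \<union> uminus ` {1..int n}"
  proof -
    have "uminus ` {1..int n} = {- int n..-1}" by simp
    then show ?thesis by (auto simp: signed_points_def)
  qed
  have pos: "peel_perm n s D ` {1..int n} = arc n s n"
    using peel_perm_image[of D n 1 s] assms by simp
  have "peel_perm n s D ` uminus ` {1..int n} = uminus ` peel_perm n s D ` {1..int n}"
    unfolding image_image by (rule image_cong) (auto simp: peel_perm_minus)
  then have neg: "peel_perm n s D ` uminus ` {1..int n} = arc n (s + n) n"
    using assms by (simp add: pos uminus_arc)
  have "peel_perm n s D ` signed_points n = arc n s n \<union> arc n (s + n) n"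
    by (simp only: pts image_Un pos neg)
  also have "\<dots> = arc n s (2 * n)"
  proof -
    have "{s..<s + 2 * n} = {s..<s + n} \<union> {s + n..<s + n + n}" by auto
    then show ?thesis by (simp add: arc_def image_Un)
  qed
  also have "\<dots> = signed_points n" using signed_points_eq_arc assms by simp
  finally have surj: "peel_perm n s D ` signed_points n = signed_points n" .
  have "finite (signed_points n)" by (simp add: signed_points_def)
  then have "inj_on (peel_perm n s D) (signed_points n)"
    using surj by (simp add: eq_card_imp_inj_on)
  then have "peel_perm n s D permutes signed_points n"
    using surj by (intro bij_imp_permutes) (auto simp: bij_betw_def peel_perm_def signed_points_def)
  then show ?thesis
    by (auto simp: signed_perms_def signed_points_def peel_perm_minus)
qed

lemma peel_perm_in_B_arc_perms:
  assumes "D \<subseteq> {1..<n}" "1 \<le> n"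
  shows "peel_perm n s D \<in> B_arc_perms n"
proof -
  have "circle_interval n (peel_perm n s D ` {int j..int n})" if "j \<in> {1..n}" for j
  proof -
    have "n + 1 - j \<le> 2 * n" using that by auto
    then show ?thesis
      using that assms by (subst peel_perm_image) (auto simp: circle_interval_iff)
  qed
  then show ?thesis using peel_perm_in_signed_perms[OF assms] by (simp add: B_arc_perms_def)
qed

text \<open>The values at \<open>1, ..., n\<close> form the arc and so determine \<open>s\<close>.
  Induction on the step then recovers \<open>D\<close>, because the two ends available at step
  \<open>i\<close> are \<open>n - i\<close> places apart and hence distinct.\<close>

lemma peel_perm_inject:
  assumes "peel_perm n s D = peel_perm n t E" "D \<subseteq> {1..<n}" "E \<subseteq> {1..<n}"
    "s < 2 * n" "t < 2 * n" "1 \<le> n"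
  shows "s = t \<and> D = E"
proof
  have "arc n s n = arc n t n"
    using peel_perm_image[of D n 1 s] peel_perm_image[of E n 1 t] assms(1-3,6) by simp
  then show st: "s = t" by (rule arc_inject) (use assms(4-6) in simp_all)
  have same: "peel_perm n t D = peel_perm n t E" using assms(1) unfolding st .
  have "D \<inter> {1..<i} = E \<inter> {1..<i}" if "1 \<le> i" "i \<le> n" for i
    using that
  proof (induction i rule: dec_induct)
    case (step i)
    then have i: "1 \<le> i" "i < n" by simp_all
    have IH: "D \<inter> {1..<i} = E \<inter> {1..<i}" by (rule step.IH) (use i in simp)
    have lr: "lefts D i = lefts E i" "rights D i = rights E i"
      by (rule lefts_cong[OF IH], rule rights_cong[OF IH])
    define d where "d = n - i"
    have "n - 1 - rights D i = lefts D i + d"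
      using lefts_rights[of D i] i by (simp add: d_def)
    then have pos: "peel_pos n t D i = t + lefts D i + (if i \<in> D then d else 0)"
      "peel_pos n t E i = t + lefts D i + (if i \<in> E then d else 0)"
      using lr by (simp_all add: peel_pos_def)
    have "cyc_point n (peel_pos n t D i) = cyc_point n (peel_pos n t E i)"
      using peel_perm_of_nat[of i n t D] peel_perm_of_nat[of i n t E] i same by simp
    moreover have "cyc_point n (t + lefts D i + d) \<noteq> cyc_point n (t + lefts D i)"
      using i by (intro cyc_point_add_neq) (auto simp: d_def)
    ultimately have "i \<in> D \<longleftrightarrow> i \<in> E"
      unfolding pos by (auto split: if_splits)
    moreover have "{1..<Suc i} = insert i {1..<i}" using i by auto
    ultimately show ?case using IH by (simp add: Int_insert_right)
  qed simp
  from this[of n] assms(6) have "D \<inter> {1..<n} = E \<inter> {1..<n}" by simp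
  then show "D = E" using assms(2,3) by (simp add: Int_absorb2)
qed

text \<open>Induction on \<open>j\<close>: \<open>D\<close> records only the steps before
  \<open>j\<close>, and \<open>arc_remove\<close> then decides step \<open>j\<close>.\<close>

lemma B_arc_perm_partial_peel:
  assumes \<pi>: "\<pi> \<in> B_arc_perms n" and start: "\<pi> ` {int 1..int n} = arc n s n"
    and "1 \<le> j" "j \<le> n"
  shows "\<exists>D. D \<subseteq> {1..<j} \<and> (\<forall>i\<in>{1..<j}. \<pi> (int i) = cyc_point n (peel_pos n s D i)) \<and>
           \<pi> ` {int j..int n} = arc n (s + lefts D j) (n + 1 - j)"
  using assms(3,4)
proof (induction j rule: dec_induct)
  case base
  then show ?case using start by (intro exI[of _ "{}"]) auto
next
  case (step j)
  then have j: "1 \<le> j" "j < n" by simp_all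
  from step obtain D where D: "D \<subseteq> {1..<j}" "\<forall>i\<in>{1..<j}. \<pi> (int i) = cyc_point n (peel_pos n s D i)"
    "\<pi> ` {int j..int n} = arc n (s + lefts D j) (n + 1 - j)"
    by auto
  have "inj \<pi>" using \<pi> by (auto simp: B_arc_perms_def signed_perms_def permutes_inj)
  have "Suc j \<in> {1..n}" using j by simp
  then have "circle_interval n (\<pi> ` {int (Suc j)..int n})"
    using \<pi> unfolding B_arc_perms_def by blast
  then obtain t m where tm: "m \<le> 2 * n" "\<pi> ` {int (Suc j)..int n} = arc n t m"
    by (auto simp: circle_interval_iff)
  have "card (\<pi> ` {int (Suc j)..int n}) = n - j"
    using j \<open>inj \<pi>\<close> by (subst card_image) (auto simp: inj_on_def inj_def)
  then have m: "m = n - j" using tm card_arc by simp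
  have eq: "{int j..int n} = insert (int j) {int (Suc j)..int n}" using j by auto
  have sz: "n + 1 - j = Suc (n - j)" using j by simp
  have "arc n (s + lefts D j) (Suc (n - j)) - {\<pi> (int j)} = arc n t (n - j)"
    unfolding D(3)[unfolded sz, symmetric] tm(2)[unfolded m, symmetric] eq
    by (auto dest: injD[OF \<open>inj \<pi>\<close>])
  moreover have "\<pi> (int j) \<in> arc n (s + lefts D j) (Suc (n - j))"
    unfolding D(3)[unfolded sz, symmetric] eq by simp
  moreover have "0 < n - j" "Suc (n - j) < 2 * n" using j by auto
  ultimately consider (l) "\<pi> (int j) = cyc_point n (s + lefts D j)"
      "arc n t (n - j) = arc n (Suc (s + lefts D j)) (n - j)"
    | (r) "\<pi> (int j) = cyc_point n (s + lefts D j + (n - j))"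
      "arc n t (n - j) = arc n (s + lefts D j) (n - j)"
    using arc_remove[of n "s + lefts D j" "n - j" "\<pi> (int j)" t] by argo
  then show ?case
  proof cases
    case l
    have "j \<notin> D" using D by auto
    then have "\<forall>i\<in>{1..<Suc j}. \<pi> (int i) = cyc_point n (peel_pos n s D i)"
      using D(2) l by (auto simp: less_Suc_eq peel_pos_def)
    moreover have "\<pi> ` {int (Suc j)..int n} = arc n (s + lefts D (Suc j)) (n + 1 - Suc j)"
      using l tm m j \<open>j \<notin> D\<close> by (simp add: lefts_Suc)
    moreover have "D \<subseteq> {1..<Suc j}" using D by auto
    ultimately show ?thesis by blast
  next
    case r
    have lr: "lefts D j + rights D j = j - 1" by (rule lefts_rights)
    \<comment> \<open>The counts at \<open>i\<close> look only at steps before \<open>i\<close>, so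
      adding \<open>j\<close> to \<open>D\<close> leaves earlier positions unchanged.\<close>
    have co: "lefts (insert j D) i = lefts D i" "rights (insert j D) i = rights D i" if "i \<le> j" for i
      using that by (auto intro!: lefts_cong rights_cong)
    have "\<forall>i\<in>{1..<j}. peel_pos n s (insert j D) i = peel_pos n s D i"
      using co by (auto simp: peel_pos_def)
    moreover have "peel_pos n s (insert j D) j = s + lefts D j + (n - j)"
      using co[of j] lr j by (simp add: peel_pos_def)
    ultimately have "\<forall>i\<in>{1..<Suc j}. \<pi> (int i) = cyc_point n (peel_pos n s (insert j D) i)"
      using D(2) r by (auto simp: less_Suc_eq)
    moreover have "\<pi> ` {int (Suc j)..int n} = arc n (s + lefts (insert j D) (Suc j)) (n + 1 - Suc j)"
      using r tm m j co[of j] by (simp add: lefts_Suc)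
    moreover have "insert j D \<subseteq> {1..<Suc j}" using D j by auto
    ultimately show ?thesis by blast
  qed
qed

lemma signed_perm_eqI:
  assumes "\<pi> \<in> signed_perms n" "\<sigma> \<in> signed_perms n"
    "\<And>i. 1 \<le> i \<Longrightarrow> i \<le> n \<Longrightarrow> \<pi> (int i) = \<sigma> (int i)"
  shows "\<pi> = \<sigma>"
proof
  fix a
  have pos: "\<pi> a = \<sigma> a" if "1 \<le> a" "a \<le> int n" for a
    using assms(3)[of "nat a"] that by simp
  consider "1 \<le> a" "a \<le> int n" | "1 \<le> - a" "- a \<le> int n" | "a \<notin> signed_points n"
    unfolding signed_points_def by fastforce
  then show "\<pi> a = \<sigma> a"
  proof cases
    case 2
    then have "- a \<in> signed_points n" by (auto simp: signed_points_def)
    then have "\<pi> (- (- a)) = - \<pi> (- a)" "\<sigma> (- (- a)) = - \<sigma> (- a)"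
      using assms(1,2) unfolding signed_perms_def by blast+
    then show ?thesis using pos[OF 2] by simp
  next
    case 3
    then show ?thesis using assms(1,2) by (auto simp: signed_perms_def permutes_def)
  qed (rule pos)
qed

lemma B_arc_perm_is_peel_perm:
  assumes "\<pi> \<in> B_arc_perms n" "1 \<le> n"
  obtains s D where "s < 2 * n" "D \<subseteq> {1..<n}" "\<pi> = peel_perm n s D"
proof -
  have sp: "\<pi> \<in> signed_perms n" using assms by (simp add: B_arc_perms_def)
  then have "inj \<pi>" by (auto simp: signed_perms_def permutes_inj)
  have "1 \<in> {1..n}" using assms by simp
  then have "circle_interval n (\<pi> ` {int 1..int n})"
    using assms(1) unfolding B_arc_perms_def by blast
  then obtain t m where tm: "m \<le> 2 * n" "\<pi> ` {int 1..int n} = arc n t m"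
    by (auto simp: circle_interval_iff)
  have "card (\<pi> ` {int 1..int n}) = n"
    using \<open>inj \<pi>\<close> by (subst card_image) (auto simp: inj_on_def inj_def)
  then have "m = n" using tm card_arc by simp
  define s where "s = t mod (2 * n)"
  have s: "s < 2 * n" "\<pi> ` {int 1..int n} = arc n s n"
    using tm \<open>m = n\<close> assms by (auto simp: s_def arc_mod)
  obtain D where D: "D \<subseteq> {1..<n}" "\<forall>i\<in>{1..<n}. \<pi> (int i) = cyc_point n (peel_pos n s D i)"
    "\<pi> ` {int n..int n} = arc n (s + lefts D n) (n + 1 - n)"
    using B_arc_perm_partial_peel[OF assms(1) s(2), of n] assms(2) by auto
  have "n \<notin> D" using D by auto
  then have "\<pi> (int n) = cyc_point n (peel_pos n s D n)"
    using D(3) by (simp add: arc_def peel_pos_def)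
  then have "\<forall>i\<in>{1..n}. \<pi> (int i) = cyc_point n (peel_pos n s D i)"
    using D(2) by (auto simp: le_less)
  then have "\<pi> = peel_perm n s D"
    using D(1) assms(2) by (intro signed_perm_eqI[OF sp] peel_perm_in_signed_perms)
      (auto simp: peel_perm_of_nat)
  then show ?thesis using that s(1) D(1) by blast
qed

lemma bij_betw_peel_perm:
  assumes "1 \<le> n"
  shows "bij_betw (\<lambda>(s, D). peel_perm n s D) ({..<2 * n} \<times> Pow {1..<n}) (B_arc_perms n)"
  unfolding bij_betw_def
proof
  show "inj_on (\<lambda>(s, D). peel_perm n s D) ({..<2 * n} \<times> Pow {1..<n})"
  proof (rule inj_onI)
    fix x y
    assume xy: "x \<in> {..<2 * n} \<times> Pow {1..<n}" "y \<in> {..<2 * n} \<times> Pow {1..<n}"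
      "(case x of (s, D) \<Rightarrow> peel_perm n s D) = (case y of (s, D) \<Rightarrow> peel_perm n s D)"
    obtain s D t E where "x = (s, D)" "y = (t, E)" by fastforce
    with xy show "x = y"
      using peel_perm_inject[of n s D t E] assms by simp
  qed
  show "(\<lambda>(s, D). peel_perm n s D) ` ({..<2 * n} \<times> Pow {1..<n}) = B_arc_perms n" (is "?f ` _ = _")
  proof (rule equalityI; rule subsetI)
    fix \<pi> assume "\<pi> \<in> ?f ` ({..<2 * n} \<times> Pow {1..<n})"
    then show "\<pi> \<in> B_arc_perms n" by (clarsimp simp: peel_perm_in_B_arc_perms assms)
  next
    fix \<pi> assume "\<pi> \<in> B_arc_perms n"
    then obtain s D where "s < 2 * n" "D \<subseteq> {1..<n}" "\<pi> = peel_perm n s D"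
      by (rule B_arc_perm_is_peel_perm[OF _ assms])
    then show "\<pi> \<in> ?f ` ({..<2 * n} \<times> Pow {1..<n})"
      by (intro image_eqI[of _ _ "(s, D)"]) simp_all
  qed
qed

subsection \<open>Descents\<close>

lemma rights_less:
  assumes "k \<in> D" "1 \<le> k" "k < j"
  shows "rights D k < rights D j"
proof -
  have "rights D (Suc k) \<le> rights D j"
    using assms unfolding rights_def by (intro card_mono) auto
  then show ?thesis using assms by (simp add: rights_Suc)
qed

lemma lefts_less:
  assumes "k \<notin> D" "1 \<le> k" "k < j"
  shows "lefts D k < lefts D j"
proof -
  have "lefts D (Suc k) \<le> lefts D j"
    using assms unfolding lefts_def by (intro card_mono) auto
  then show ?thesis using assms by (simp add: lefts_Suc)
qed

lemma in_Des_peel_perm_iff: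
  assumes "1 \<le> n"
  shows "i \<in> Des n (peel_perm n s D) \<longleftrightarrow>
    i \<in> {1..<n} \<and> peel_pos n s D (Suc i) mod (2 * n) < peel_pos n s D i mod (2 * n)"
proof (cases "i \<in> {1..<n}")
  case True
  have "B_less (peel_perm n s D (int (Suc i))) (peel_perm n s D (int i)) \<longleftrightarrow>
    peel_pos n s D (Suc i) mod (2 * n) < peel_pos n s D i mod (2 * n)"
    using True assms by (subst (1 2) peel_perm_of_nat) (auto simp: B_less_cyc_point_iff)
  then show ?thesis using True by (auto simp: Des_def add.commute)
qed (auto simp: Des_def)

text \<open>For \<open>s \<le> n\<close> no position reaches \<open>2 * n\<close>, so reduction
  changes nothing and \<open>peel_pos_less\<close> decides each step.\<close>

lemma Des_peel_perm:
  assumes "D \<subseteq> {1..<n}" "1 \<le> n" "s \<le> n"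
  shows "Des n (peel_perm n s D) = D"
proof -
  have "i \<in> Des n (peel_perm n s D) \<longleftrightarrow> i \<in> D" if "i \<in> {1..<n}" for i
  proof -
    have "peel_pos n s D (Suc i) < 2 * n" "peel_pos n s D i < 2 * n"
      using peel_pos_bounds[OF assms(1), of i s] peel_pos_bounds[OF assms(1), of "Suc i" s]
        that assms(3) by auto
    then show ?thesis
      using peel_pos_less[OF assms(1), of i "Suc i" s] that assms(2)
      by (auto simp: in_Des_peel_perm_iff split: if_splits)
  qed
  moreover have "Des n (peel_perm n s D) \<subseteq> {1..<n}" by (auto simp: Des_def)
  ultimately show ?thesis using assms(1) by blast
qed

section \<open>Descents for arcs across the gap\<close>

text \<open>The start of the arc for which \<open>\<pi>(k)\<close> is the last remaining point on its side of the gap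
  between positions \<open>2 * n - 1\<close> and \<open>2 * n\<close>, while the other side is still nonempty.\<close>

definition wrap_start :: "nat \<Rightarrow> nat set \<Rightarrow> nat \<Rightarrow> nat" where
  "wrap_start n D k = (if k \<in> D then n + 1 + rights D k else 2 * n - 1 - lefts D k)"

text \<open>For \<open>k\<close> in \<open>D\<close> the starts increase from \<open>n + 1\<close>
  and stay at most \<open>n + rights D n\<close>; for the other \<open>k\<close> they decrease from
  \<open>2 * n - 1\<close> and stay above that bound. This gives injectivity, and counting gives the
  rest.\<close>

lemma bij_betw_wrap_start:
  assumes "D \<subseteq> {1..<n}"
  shows "bij_betw (wrap_start n D) {1..<n} {Suc n..<2 * n}"
proof -
  have tot: "lefts D n + rights D n = n - 1" by (rule lefts_rights)
  have r: "rights D k < rights D j" if "k \<in> D" "k < j" "1 \<le> k" for k j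
    using that by (intro rights_less) auto
  have l: "lefts D k < lefts D j" if "k \<notin> D" "k < j" "1 \<le> k" for k j
    using that by (intro lefts_less) auto
  have le: "wrap_start n D k \<in> {Suc n..<2 * n}" if "k \<in> {1..<n}" for k
    using r[of k n] l[of k n] tot that by (auto simp: wrap_start_def)
  have neq: "wrap_start n D k \<noteq> wrap_start n D j" if "k \<in> {1..<n}" "j \<in> {1..<n}" "k < j" for k j
    using r[of k n] l[of k n] r[of j n] l[of j n] r[of k j] l[of k j] tot that
    by (auto simp: wrap_start_def)
  have inj: "inj_on (wrap_start n D) {1..<n}"
    by (rule linorder_inj_onI) (use neq in auto)
  moreover have "wrap_start n D ` {1..<n} = {Suc n..<2 * n}"
  proof (rule card_subset_eq)
    show "card (wrap_start n D ` {1..<n}) = card {Suc n..<2 * n}"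
      unfolding card_image[OF inj] by simp
  qed (use le in auto)
  ultimately show ?thesis by (simp add: bij_betw_def)
qed

text \<open>Up to step \<open>k\<close> right ends lie beyond the gap and have the smaller reduced
  positions; after it only one side is left, and positions compare as without wrapping.\<close>

lemma Des_peel_perm_wrap:
  assumes D: "D \<subseteq> {1..<n}" and k: "k \<in> {1..<n}"
  shows "Des n (peel_perm n (wrap_start n D k) D) =
    {i \<in> {1..<n}. if i < k then Suc i \<in> D else if i = k then k \<notin> D else i \<in> D}"
proof -
  define s where "s = wrap_start n D k"
  define p where "p = peel_pos n s D"
  have s: "n < s" "s < 2 * n"
    using bij_betw_apply[OF bij_betw_wrap_start[OF D] k] by (simp_all add: s_def)
  have lr: "lefts D k + rights D k = k - 1" by (rule lefts_rights)
  \<comment> \<open>Position \<open>2 * n\<close> reduces to 0, the least value, and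
    \<open>2 * n - 1\<close> is the greatest; this decides the descent at \<open>k\<close>.\<close>
  have pk: "p k = (if k \<in> D then 2 * n else 2 * n - 1)"
    using lr k by (auto simp: p_def peel_pos_def s_def wrap_start_def)
  have bounds: "s \<le> p i" "p i < s + n" if "i \<in> {1..n}" for i
    using peel_pos_bounds[OF D, of i s] that by (auto simp: p_def)
  have less: "if i \<in> D then p j < p i else p i < p j" if "1 \<le> i" "i < j" "j \<le> n" for i j
    using peel_pos_less[OF D that, of s] by (simp add: p_def)
  have p_mod: "p i mod (2 * n) = (if p i < 2 * n then p i else p i - 2 * n)" if "i \<in> {1..n}" for i
    using bounds[OF that] s by (simp add: le_mod_geq)
  have before: "p i < 2 * n \<longleftrightarrow> i \<notin> D" if "1 \<le> i" "i \<le> k" for i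
    using less[of i k] pk k that by (cases "i = k") (auto split: if_splits)
  have after: "p i < 2 * n \<longleftrightarrow> k \<in> D" if "k < i" "i \<le> n" for i
    using less[of k i] pk k that by (auto split: if_splits)
  have "p (Suc i) mod (2 * n) < p i mod (2 * n) \<longleftrightarrow>
      (if i < k then Suc i \<in> D else if i = k then k \<notin> D else i \<in> D)" if i: "i \<in> {1..<n}" for i
  proof -
    have m: "p i mod (2 * n) = (if p i < 2 * n then p i else p i - 2 * n)"
      "p (Suc i) mod (2 * n) = (if p (Suc i) < 2 * n then p (Suc i) else p (Suc i) - 2 * n)"
      using p_mod i by auto
    have b: "s \<le> p i" "p i < s + n" "s \<le> p (Suc i)" "p (Suc i) < s + n"
      using bounds[of i] bounds[of "Suc i"] i by auto
    have l: "if i \<in> D then p (Suc i) < p i else p i < p (Suc i)"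
      using less[of i "Suc i"] i by simp
    consider "i < k" | "i = k" | "k < i" by linarith
    then show ?thesis
    proof cases
      \<comment> \<open>On different sides of the gap, only the side of \<open>Suc i\<close>
        matters. On the same side, right removals go down and left ones up, which gives the same
        criterion.\<close>
      case 1
      then show ?thesis
        using before[of i] before[of "Suc i"] m b l s i by (auto split: if_splits)
    next
      case 2
      then show ?thesis
        using pk after[of "Suc i"] m b l s i by (auto split: if_splits)
    next
      case 3
      then show ?thesis
        using after[of i] after[of "Suc i"] m b l s i by (auto split: if_splits)
    qed
  qed
  then show ?thesis
    using k by (auto simp: in_Des_peel_perm_iff simp flip: s_def p_def)
qed

subsection \<open>Summation over the peeling choices\<close>

text \<open>Expansion of a product of binomials, used backwards: a sum over \<open>D\<close>
  factorises once each element has its own factor depending only on its membership.\<close>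

lemma sum_Pow_prod_if:
  fixes f g :: "'a \<Rightarrow> 'b :: comm_semiring_1"
  assumes "finite A"
  shows "(\<Sum>D\<in>Pow A. \<Prod>i\<in>A. if i \<in> D then f i else g i) = (\<Prod>i\<in>A. f i + g i)"
proof -
  have "(\<Prod>i\<in>A. if i \<in> D then f i else g i) = prod f D * prod g (A - D)" if "D \<in> Pow A" for D
  proof -
    have "A \<inter> D = D" "A \<inter> - D = A - D" using that by auto
    then show ?thesis using assms by (simp add: prod.If_cases)
  qed
  then show ?thesis using assms by (simp add: prod_add)
qed

lemma prod_atLeastLessThan_split:
  fixes f :: "nat \<Rightarrow> 'a :: comm_monoid_mult"
  assumes "a \<le> k" "k < b"
  shows "prod f {a..<b} = prod f {a..<k} * f k * prod f {Suc k..<b}"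
proof -
  have "prod f {a..<b} = prod f {a..<Suc k} * prod f {Suc k..<b}"
    using assms by (intro prod.atLeastLessThan_concat[symmetric]) simp_all
  then show ?thesis using assms by simp
qed

text \<open>Before step \<open>k\<close> the descent at \<open>i\<close> depends on the choice at \<open>i + 1\<close>; regrouping by choices
  gives each \<open>j\<close> its own factor, so that \<open>sum_Pow_prod_if\<close> applies. The choice at \<open>1\<close> is free
  if \<open>k > 1\<close>, and the choice at \<open>k\<close> selects between \<open>x (k - 1)\<close> and \<open>x k\<close>.\<close>

lemma prod_wrap_descents:
  fixes x :: "nat \<Rightarrow> 'a :: comm_semiring_1"
  assumes "1 \<le> k" "k < n"
  shows "(\<Prod>i\<in>{1..<n}. if (if i < k then Suc i \<in> D else if i = k then k \<notin> D else i \<in> D) then x i else 1) =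
    (\<Prod>j\<in>{1..<n}. if j \<in> D then (if j \<le> k then if j = 1 then 1 else x (j - 1) else x j)
                     else (if j = k then x k else 1))"
    (is "prod ?L _ = prod ?R _")
proof -
  \<comment> \<open>\<open>h (Suc i)\<close> is the factor of the descent at \<open>i\<close>, moved
    to the choice that causes it. The value 1 at 1 lets the shifted range start at 1.\<close>
  define h where "h j = (if j \<in> D \<and> j \<noteq> 1 then x (j - 1) else 1)" for j
  have "prod ?L {1..<k} = (\<Prod>i\<in>{1..<k}. h (Suc i))"
    by (rule prod.cong) (auto simp: h_def)
  also have "\<dots> = prod h {Suc 1..<Suc k}" by (simp only: prod.shift_bounds_Suc_ivl)
  also have "\<dots> = prod h {1..<Suc k}"
    using assms prod.atLeast_Suc_lessThan[of 1 "Suc k" h] by (simp add: h_def)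
  also have "\<dots> = prod h {1..<k} * h k" using assms by simp
  also have "prod h {1..<k} = prod ?R {1..<k}"
    by (rule prod.cong) (auto simp: h_def)
  finally have "prod ?L {1..<k} * ?L k = prod ?R {1..<k} * (h k * ?L k)" by (simp add: mult.assoc)
  \<comment> \<open>\<open>h k\<close> can contribute only for \<open>k\<close> in \<open>D\<close>,
    and \<open>?L k\<close> only for \<open>k\<close> outside \<open>D\<close>.\<close>
  also have "h k * ?L k = ?R k" by (auto simp: h_def)
  finally have "prod ?L {1..<k} * ?L k = prod ?R {1..<k} * ?R k" .
  moreover have "prod ?L {Suc k..<n} = prod ?R {Suc k..<n}"
    by (rule prod.cong) auto
  ultimately show ?thesis
    using prod_atLeastLessThan_split[of 1 k n ?L] prod_atLeastLessThan_split[of 1 k n ?R] assms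
    by simp
qed

text \<open>For \<open>k > 1\<close>, once choices are separated, \<open>j = 1\<close> yields 2,
  each later \<open>j < k\<close> yields \<open>1 + x (j - 1)\<close>, and \<open>k\<close> yields
  \<open>x (k - 1) + x k\<close>. Compared with the full product, \<open>1 + x (k - 1)\<close> and
  \<open>1 + x k\<close> are missing, hence the quotient.\<close>

lemma sum_wrap_descents:
  fixes x :: "nat \<Rightarrow> 'a :: field"
  assumes "\<And>i. 1 + x i \<noteq> 0" "1 \<le> k" "k < n"
  shows "(\<Sum>D\<in>Pow {1..<n}. \<Prod>i\<in>{1..<n}.
      if (if i < k then Suc i \<in> D else if i = k then k \<notin> D else i \<in> D) then x i else 1) =
    (\<Prod>i\<in>{1..<n}. 1 + x i) *
      (if k = 1 then 1 else 2 * ((x (k - 1) + x k) / ((1 + x (k - 1)) * (1 + x k))))"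
proof -
  define G where "G j = (if j \<le> k then if j = 1 then 1 else x (j - 1) else x j) +
    (if j = k then x k else 1)" for j
  have "(\<Sum>D\<in>Pow {1..<n}. \<Prod>i\<in>{1..<n}.
      if (if i < k then Suc i \<in> D else if i = k then k \<notin> D else i \<in> D) then x i else 1) =
    prod G {1..<n}"
    unfolding prod_wrap_descents[OF assms(2,3)] G_def by (rule sum_Pow_prod_if) simp
  also have "\<dots> = (\<Prod>i\<in>{1..<n}. 1 + x i) *
      (if k = 1 then 1 else 2 * ((x (k - 1) + x k) / ((1 + x (k - 1)) * (1 + x k))))"
  proof (cases "k = 1")
    case True
    then have "prod G {1..<n} = (\<Prod>i\<in>{1..<n}. 1 + x i)"
      by (intro prod.cong) (auto simp: G_def)
    then show ?thesis using True by simp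
  next
    case False
    then obtain m where m: "k = Suc m" "1 \<le> m" using assms(2) by (cases k) auto
    define P Q where "P = (\<Prod>i\<in>{1..<m}. 1 + x i)" and "Q = (\<Prod>i\<in>{Suc k..<n}. 1 + x i)"
    have "prod G {1..<k} = G 1 * prod G {Suc 1..<Suc m}"
      using prod.atLeast_Suc_lessThan[of 1 k G] m by simp
    also have "prod G {Suc 1..<Suc m} = (\<Prod>i\<in>{1..<m}. G (Suc i))"
      by (simp only: prod.shift_bounds_Suc_ivl)
    also have "\<dots> = P"
      unfolding P_def using m by (intro prod.cong) (auto simp: G_def)
    also have "G 1 = 2" using m by (simp add: G_def)
    finally have 1: "prod G {1..<k} = 2 * P" .
    have 2: "prod G {Suc k..<n} = Q"
      unfolding Q_def by (intro prod.cong) (auto simp: G_def)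
    have "prod G {1..<n} = 2 * P * (x m + x k) * Q"
      using prod_atLeastLessThan_split[of 1 k n G] assms(2,3) 1 2 m by (simp add: G_def)
    moreover have "(\<Prod>i\<in>{1..<n}. 1 + x i) = P * (1 + x m) * (1 + x k) * Q"
      using prod_atLeastLessThan_split[of 1 k n "\<lambda>i. 1 + x i"] assms(2,3) m
      by (simp add: P_def Q_def)
    moreover have "2 * P * y * Q = P * a * b * Q * (2 * (y / (a * b)))"
      if "a \<noteq> 0" "b \<noteq> 0" for a b y
      using that by (simp add: field_simps)
    ultimately show ?thesis
      using assms(1) m by simp
  qed
  finally show ?thesis .
qed

text \<open>The constant coefficient of the polynomial is 1, as a variable is not the unit
  monomial.\<close>

lemma one_plus_X_nonzero: "1 + X i \<noteq> 0"
proof -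
  have "Poly_Mapping.single i (1 :: nat) \<noteq> 0"
    by (metis lookup_single_eq lookup_zero zero_neq_one)
  then have "Poly_Mapping.lookup (1 + Poly_Mapping.single (Poly_Mapping.single i (1 :: nat)) (1 :: int)) 0 = 1"
    by (simp add: lookup_add lookup_single when_def)
  then have "1 + Poly_Mapping.single (Poly_Mapping.single i (1 :: nat)) (1 :: int) \<noteq> 0"
    by auto
  then show ?thesis by (simp add: X_def One_fract_def Zero_fract_def eq_fract)
qed

lemma X_pow_set_filter:
  "X_pow_set {i \<in> {1..<n}. P i} = (\<Prod>i\<in>{1..<n}. if P i then X i else 1)"
  unfolding X_pow_set_def by (rule prod.inter_filter) simp

theorem theorem5p11:
  fixes n :: nat
  assumes "n \<ge> 2"
  shows "(\<Sum>\<pi>\<in>B_arc_perms n. X_pow_set (Des n \<pi>)) =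
    (\<Prod>i=1..n - 1. 1 + X i) *
      (2 + of_nat n + 2 * (\<Sum>i=1..n - 2. (X i + X (i + 1)) / ((1 + X i) * (1 + X (i + 1)))))"
proof -
  define P where "P = (\<Prod>i\<in>{1..<n}. 1 + X i)"
  define c where "c i = (X i + X (i + 1)) / ((1 + X i) * (1 + X (i + 1)))" for i
  define F where "F s = (\<Sum>D\<in>Pow {1..<n}. X_pow_set (Des n (peel_perm n s D)))" for s
  have n: "1 \<le> n" using assms by simp
  have "(\<Sum>\<pi>\<in>B_arc_perms n. X_pow_set (Des n \<pi>)) = (\<Sum>s<2 * n. F s)"
    unfolding F_def sum.cartesian_product
    by (subst sum.reindex_bij_betw[OF bij_betw_peel_perm[OF n], symmetric])
      (simp add: case_prod_beta)
  also have "{..<2 * n} = {..n} \<union> {Suc n..<2 * n}" using assms by auto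
  also have "sum F \<dots> = sum F {..n} + sum F {Suc n..<2 * n}"
    by (rule sum.union_disjoint) auto
  also have "sum F {..n} = of_nat (n + 1) * P"
  proof -
    have "F s = P" if "s \<le> n" for s
    proof -
      have "F s = (\<Sum>D\<in>Pow {1..<n}. \<Prod>i\<in>{1..<n}. if i \<in> D then X i else 1)"
        unfolding F_def
      proof (rule sum.cong[OF refl])
        fix D assume "D \<in> Pow {1..<n}"
        then have "D = {i \<in> {1..<n}. i \<in> D}" "D \<subseteq> {1..<n}" by auto
        then show "X_pow_set (Des n (peel_perm n s D)) = (\<Prod>i\<in>{1..<n}. if i \<in> D then X i else 1)"
          using Des_peel_perm[OF _ n that] X_pow_set_filter by metis
      qed
      then show ?thesis by (simp add: sum_Pow_prod_if P_def add.commute)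
    qed
    then show ?thesis by simp
  qed
  also have "sum F {Suc n..<2 * n} = P * (1 + 2 * (\<Sum>i=1..n - 2. c i))"
  proof -
    \<comment> \<open>The reindexing by \<open>wrap_start\<close> depends on \<open>D\<close>, so
      the sum over \<open>D\<close> is moved outside here, and back inside later to factorise for
      fixed \<open>k\<close>.\<close>
    have "sum F {Suc n..<2 * n} =
        (\<Sum>D\<in>Pow {1..<n}. \<Sum>s\<in>{Suc n..<2 * n}. X_pow_set (Des n (peel_perm n s D)))"
      unfolding F_def by (rule sum.swap)
    also have "\<dots> = (\<Sum>D\<in>Pow {1..<n}. \<Sum>k\<in>{1..<n}. \<Prod>i\<in>{1..<n}.
        if (if i < k then Suc i \<in> D else if i = k then k \<notin> D else i \<in> D) then X i else 1)"
    proof (rule sum.cong[OF refl])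
      fix D assume "D \<in> Pow {1..<n}"
      then have D: "D \<subseteq> {1..<n}" by simp
      show "(\<Sum>s\<in>{Suc n..<2 * n}. X_pow_set (Des n (peel_perm n s D))) =
        (\<Sum>k\<in>{1..<n}. \<Prod>i\<in>{1..<n}.
          if (if i < k then Suc i \<in> D else if i = k then k \<notin> D else i \<in> D) then X i else 1)"
        unfolding sum.reindex_bij_betw[OF bij_betw_wrap_start[OF D], symmetric]
        by (rule sum.cong[OF refl]) (simp only: Des_peel_perm_wrap[OF D] X_pow_set_filter)
    qed
    also have "\<dots> = (\<Sum>k\<in>{1..<n}. P * (if k = 1 then 1 else 2 * c (k - 1)))"
      unfolding P_def c_def
      by (subst sum.swap, rule sum.cong[OF refl], subst sum_wrap_descents[OF one_plus_X_nonzero]) auto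
    also have "\<dots> = P * (\<Sum>k\<in>{1..<n}. if k = 1 then 1 else 2 * c (k - 1))"
      by (simp only: sum_distrib_left)
    \<comment> \<open>The term \<open>k = 1\<close> splits off; the shift \<open>i = k - 1\<close>
      then produces the stated range.\<close>
    also have "(\<Sum>k\<in>{1..<n}. if k = 1 then 1 else 2 * c (k - 1)) = 
        1 + (\<Sum>k\<in>{Suc 1..<Suc (n - 1)}. if k = 1 then 1 else 2 * c (k - 1))"
      using assms by (simp add: sum.atLeast_Suc_lessThan)
    also have "(\<Sum>k\<in>{Suc 1..<Suc (n - 1)}. if k = 1 then 1 else 2 * c (k - 1)) = (\<Sum>i\<in>{1..<n - 1}. 2 * c i)"
      unfolding sum.shift_bounds_Suc_ivl by (rule sum.cong) auto
    also have "{1..<n - 1} = {1..n - 2}" using assms by auto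
    finally show ?thesis by (simp only: sum_distrib_left)
  qed
  \<comment> \<open>The \<open>n + 1\<close> unwrapped starts and the term \<open>k = 1\<close>
    together give \<open>n + 2\<close>.\<close>
  also have "of_nat (n + 1) * P + P * (1 + 2 * (\<Sum>i=1..n - 2. c i)) =
      P * (2 + of_nat n + 2 * (\<Sum>i=1..n - 2. c i))"
    by (simp add: algebra_simps)
  also have "P = (\<Prod>i=1..n - 1. 1 + X i)"
    unfolding P_def using assms by (intro prod.cong) auto
  finally show ?thesis unfolding c_def .
qed

end
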